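(* Let $K$ be a finite simplicial complex over a vertex set $V=\{v_1,\ldots,v_m\}$, let $P$ be a finite poset, let $\mathsf{F}:P\to\mathsf{SubCx}(K)$ be a filtration and $\rho\ge0$ an integer. For any permutation $\xi:\{1,\ldots,m\}\to\{1,\ldots,m\}$ and any segment $(b,d)\in\mathsf{Seg}(P)$, $$\Omega_\rho^{\xi}\Big(\mathsf{OI}(\mathsf{ZB}_\rho^{\mathsf{F}})((b,d))\Big)=\mathsf{OI}\big(\mathsf{ZB}_\rho^{\xi(\mathsf{F})}\big)((b,d)).$$
   Context: Relabelling: given a permutation $\xi$ of $\{1,\ldots,m\}$ and a vertex set $W=\{w_1,\ldots,w_m\}$, $\xi(K)$ is the simplicial complex over $W$ with $\{v_{i_0},\ldots,v_{i_\rho}\}\in K\iff\{w_{\xi(i_0)},\ldots,w_{\xi(i_\rho)}\}\in\xi(K)$. The filtration $\xi(\mathsf{F}):P\to\mathsf{SubCx}(\xi(K))$ is given by $\{v_{i_0},\ldots,v_{i_\rho}\}\in\mathsf{F}(a)\iff\{w_{\xi(i_0)},\ldots,w_{\xi(i_\rho)}\}\in\xi(\mathsf{F})(a)$ for $a\in P$. The canonical isomorphism $\Omega_\rho^\xi:C_\rho^K\to C_\rho^{\xi(K)}$ is the linear map $[v_{i_0},\ldots,v_{i_\rho}]\mapsto[w_{\xi(i_0)},\ldots,w_{\xi(i_\rho)}]$, where (as usual for oriented simplices) an oriented simplex whose vertices are listed in a permuted order equals the sign of the permutation times the one listed in the vertex order. Segments: $\mathsf{Seg}(P)$ consists of all pairs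 $(b,d)$ with $b\le d$ in $P$ (including $(a,a)$) together with a pair $(a,\infty)$ for each $a\in P$; product order $(b_1,d_1)\le_\times(b_2,d_2)\iff b_1\le b_2$ and $d_1\le d_2$, where $p<\infty$ for all $p\in P$. Chains: for a finite simplicial complex $K$ over a finite totally ordered vertex set, $C_\rho^K$ is the real vector space with basis the oriented $\rho$-simplices of $K$ (oriented by the vertex order), with the inner product making this basis orthonormal, and the usual simplicial boundary operators. For a subcomplex $L\subseteq K$, $\mathsf{Z}_\rho(L)$ and $\mathsf{B}_\rho(L)$ are the $\rho$-cycles and $\rho$-boundaries of $L$, viewed as subspaces of $C_\rho^K$. $\mathsf{SubCx}(K)$ is the poset of subcomplexes of $K$ under inclusion; a filtration is an order-preserving map into it. Birth-death spaces: $\mathsf{ZB}_\rho^{\mathsf{F}}((b,d)) := \mathsf{Z}_\rho(\mathsf{F}(b))\cap\mathsf{B}_\rho(\mathsf{F}(d))$ for $b\le d$ in $P$, $\mathsf{ZB}_\rho^{\mathsf{F}}((b,\infty)) := \mathsf{Z}_\rho(\mathsf{F}(b))$. Orthogonal Inverse: $\mathsf{OI}(\mathsf{ZB}_\rho^{\mathsf{F}})((b,d)) := \mathsf{ZB}_\rho^{\mathsf{F}}((b,d))\cap\big(\sum_{(a,c)<_\times(b,d)}\mathsf{ZB}_\rho^{\mathsf{F}}((a,c))\big)^\perp$ (empty sum is $\{0\}$; $\perp$ in the chain space). *)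

theory Defs
  imports
    "HOL-Analysis.Finite_Function_Topology"
    "HOL-Combinatorics.Permutations"
    "HOL-Library.Extended"
    "HOL-Library.Product_Order"
    "HOL-Library.Set_Algebras"
begin

section \<open>Simplicial complexes\<close>

definition simplicial_complex :: "'v set \<Rightarrow> 'v set set \<Rightarrow> bool" where
  "simplicial_complex V K \<longleftrightarrow>
     finite V \<and> (\<forall>\<sigma>\<in>K. \<sigma> \<noteq> {} \<and> \<sigma> \<subseteq> V) \<and> (\<forall>\<sigma>\<in>K. \<forall>\<tau>. \<tau> \<noteq> {} \<and> \<tau> \<subseteq> \<sigma> \<longrightarrow> \<tau> \<in> K)"

definition SubCx :: "'v set set \<Rightarrow> 'v set set set" where
  "SubCx K = {L. L \<subseteq> K \<and> (\<forall>\<sigma>\<in>L. \<forall>\<tau>. \<tau> \<noteq> {} \<and> \<tau> \<subseteq> \<sigma> \<longrightarrow> \<tau> \<in> L)}"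

definition simplices :: "'v set set \<Rightarrow> nat \<Rightarrow> 'v set set" where
  "simplices K \<rho> = {\<sigma> \<in> K. card \<sigma> = \<rho> + 1}"


section \<open>Chains\<close>

text \<open>
  A vertex set is enumerated as \<open>v 1, \<dots>, v m\<close>, and the enumeration is the vertex order.
  A chain is a finitely supported function on simplices: \<open>single \<sigma> 1\<close> is the basis element
  given by \<open>\<sigma>\<close> oriented by the vertex order. The chains of a subcomplex are thereby
  literally a subspace of those of the complex.
\<close>

definition chains :: "'v set set \<Rightarrow> nat \<Rightarrow> ('v set \<Rightarrow>\<^sub>0 real) set" where
  "chains K \<rho> = {c. Poly_Mapping.keys c \<subseteq> simplices K \<rho>}"

definition chain_inner ::
    "'v set set \<Rightarrow> nat \<Rightarrow> ('v set \<Rightarrow>\<^sub>0 real) \<Rightarrow> ('v set \<Rightarrow>\<^sub>0 real) \<Rightarrow> real" where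
  "chain_inner K \<rho> c d =
     (\<Sum>\<sigma>\<in>simplices K \<rho>. Poly_Mapping.lookup c \<sigma> * Poly_Mapping.lookup d \<sigma>)"

definition chain_perp ::
    "'v set set \<Rightarrow> nat \<Rightarrow> ('v set \<Rightarrow>\<^sub>0 real) set \<Rightarrow> ('v set \<Rightarrow>\<^sub>0 real) set" where
  "chain_perp K \<rho> U = {c \<in> chains K \<rho>. \<forall>u\<in>U. chain_inner K \<rho> c u = 0}"

text \<open>The sign of the permutation sorting a list of distinct indices.\<close>

definition list_sign :: "nat list \<Rightarrow> int" where
  "list_sign is = sign (THE p. p permutes {..<length is} \<and> permute_list p is = sort is)"

text \<open>
  \<open>oriented_simplex v [i\<^sub>0, \<dots>, i\<^sub>\<rho>]\<close> is the oriented simplex \<open>[v i\<^sub>0, \<dots>, v i\<^sub>\<rho>]\<close> for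
  distinct indices in any order.
\<close>

definition oriented_simplex :: "(nat \<Rightarrow> 'v) \<Rightarrow> nat list \<Rightarrow> ('v set \<Rightarrow>\<^sub>0 real)" where
  "oriented_simplex v is = of_int (list_sign is) *\<^sub>R Poly_Mapping.single (v ` set is) 1"

text \<open>The indices of the vertices of a simplex, in increasing order.\<close>

definition vertex_indices :: "(nat \<Rightarrow> 'v) \<Rightarrow> nat \<Rightarrow> 'v set \<Rightarrow> nat list" where
  "vertex_indices v m \<sigma> = sorted_list_of_set {i \<in> {1..m}. v i \<in> \<sigma>}"

text \<open>The boundary operator on \<open>\<rho>\<close>-chains; there are no chains in degree \<open>-1\<close>.\<close>

definition boundary :: "(nat \<Rightarrow> 'v) \<Rightarrow> nat \<Rightarrow> nat \<Rightarrow> ('v set \<Rightarrow>\<^sub>0 real) \<Rightarrow> ('v set \<Rightarrow>\<^sub>0 real)" where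
  "boundary v m \<rho> c =
     (if \<rho> = 0 then 0
      else \<Sum>\<sigma>\<in>Poly_Mapping.keys c. Poly_Mapping.lookup c \<sigma> *\<^sub>R
        (\<Sum>j\<le>\<rho>. (-1) ^ j *\<^sub>R
          oriented_simplex v
            (take j (vertex_indices v m \<sigma>) @ drop (Suc j) (vertex_indices v m \<sigma>))))"

definition cycles :: "(nat \<Rightarrow> 'v) \<Rightarrow> nat \<Rightarrow> nat \<Rightarrow> 'v set set \<Rightarrow> ('v set \<Rightarrow>\<^sub>0 real) set" where
  "cycles v m \<rho> L = {c \<in> chains L \<rho>. boundary v m \<rho> c = 0}"

definition boundaries :: "(nat \<Rightarrow> 'v) \<Rightarrow> nat \<Rightarrow> nat \<Rightarrow> 'v set set \<Rightarrow> ('v set \<Rightarrow>\<^sub>0 real) set" where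
  "boundaries v m \<rho> L = boundary v m (\<rho> + 1) ` chains L (\<rho> + 1)"


section \<open>Segments, birth-death spaces and the orthogonal inverse\<close>

text \<open>
  The value \<^const>\<open>Pinf\<close> is the death time of the segments \<open>(a, \<infinity>)\<close>; \<^const>\<open>Minf\<close> never occurs
  in a segment. The order on segments is the product order of \<^theory>\<open>HOL-Library.Product_Order\<close>,
  and \<open><\<close> is its strict part.
\<close>

definition Seg :: "('p::order \<times> 'p extended) set" where
  "Seg = {(b, Fin d) | b d. b \<le> d} \<union> {(a, Pinf) | a. True}"

definition filtration :: "'v set set \<Rightarrow> ('p::order \<Rightarrow> 'v set set) \<Rightarrow> bool" where
  "filtration K F \<longleftrightarrow> range F \<subseteq> SubCx K \<and> mono F"

fun ZB :: "(nat \<Rightarrow> 'v) \<Rightarrow> nat \<Rightarrow> nat \<Rightarrow> ('p \<Rightarrow> 'v set set) \<Rightarrow> 'p \<times> 'p extended \<Rightarrow>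
    ('v set \<Rightarrow>\<^sub>0 real) set" where
  "ZB v m \<rho> F (b, Fin d) = cycles v m \<rho> (F b) \<inter> boundaries v m \<rho> (F d)"
| "ZB v m \<rho> F (b, Pinf) = cycles v m \<rho> (F b)"
| "ZB v m \<rho> F (b, Minf) = undefined"

text \<open>The sum is the sum of subspaces from \<^theory>\<open>HOL-Library.Set_Algebras\<close>; the empty sum is \<open>{0}\<close>.\<close>

definition OI :: "'v set set \<Rightarrow> nat \<Rightarrow> ('p::{finite,order} \<times> 'p extended \<Rightarrow> ('v set \<Rightarrow>\<^sub>0 real) set) \<Rightarrow>
    'p \<times> 'p extended \<Rightarrow> ('v set \<Rightarrow>\<^sub>0 real) set" where
  "OI K \<rho> M s = M s \<inter> chain_perp K \<rho> (\<Sum>t\<in>{t \<in> Seg. t < s}. M t)"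


section \<open>Relabelling\<close>

definition relabel ::
    "(nat \<Rightarrow> 'v) \<Rightarrow> (nat \<Rightarrow> 'w) \<Rightarrow> nat \<Rightarrow> (nat \<Rightarrow> nat) \<Rightarrow> 'v set set \<Rightarrow> 'w set set" where
  "relabel v w m \<xi> K = {w ` \<xi> ` I | I. I \<subseteq> {1..m} \<and> v ` I \<in> K}"

definition relabel_filtration ::
    "(nat \<Rightarrow> 'v) \<Rightarrow> (nat \<Rightarrow> 'w) \<Rightarrow> nat \<Rightarrow> (nat \<Rightarrow> nat) \<Rightarrow> ('p \<Rightarrow> 'v set set) \<Rightarrow> 'p \<Rightarrow> 'w set set" where
  "relabel_filtration v w m \<xi> F a = relabel v w m \<xi> (F a)"

text \<open>
  The linear map with \<open>[v i\<^sub>0, \<dots>, v i\<^sub>\<rho>] \<mapsto> [w (\<xi> i\<^sub>0), \<dots>, w (\<xi> i\<^sub>\<rho>)]\<close>, given by its values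
  on the basis; \<open>\<xi>\<close> need not preserve the order of the indices, so signs appear.
\<close>

definition Omega :: "(nat \<Rightarrow> 'v) \<Rightarrow> (nat \<Rightarrow> 'w) \<Rightarrow> nat \<Rightarrow> (nat \<Rightarrow> nat) \<Rightarrow>
    ('v set \<Rightarrow>\<^sub>0 real) \<Rightarrow> ('w set \<Rightarrow>\<^sub>0 real)" where
  "Omega v w m \<xi> c =
     (\<Sum>\<sigma>\<in>Poly_Mapping.keys c. Poly_Mapping.lookup c \<sigma> *\<^sub>R
        oriented_simplex w (map \<xi> (vertex_indices v m \<sigma>)))"

end

theory Submission
  imports Defs
begin

text \<open>
  Write \<open>\<Omega>\<close> for the relabelling map on chains. Up to signs it is the permutation of bases
  \<open>\<sigma> \<mapsto> \<xi>(\<sigma>)\<close>. Hence it maps the chains of a subcomplex \<open>L\<close> bijectively onto those of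
  \<open>\<xi>(L)\<close>, and, the signs having square \<open>1\<close>, it is an isometry. The orthogonal inverse is built
  from chain spaces, the boundary operator and orthogonality by kernels, images, intersections,
  sums and complements. A bijective linear isometry respects each of these operations, so the
  theorem follows once \<open>\<Omega>\<close> is known to commute with the boundary operators.

  This is where the signs matter, as the boundary operators on the two sides use unrelated vertex
  orders. The point is that deleting the vertices of a simplex one at a time, with alternating
  signs, is compatible with reordering its vertices. The sign of a list of distinct indices is
  \<open>(-1)\<close> to its number of inversions (\<open>list_sign_inversions\<close>), and removing an entry \<open>x\<close> in
  position \<open>j\<close> changes that number by \<open>j\<close> plus the rank of \<open>x\<close> in the list, modulo \<open>2\<close>
  (\<open>list_sign_remove\<close>). The alternating sum of facets of a list is therefore its sign times an
  expression that sees only the underlying set (\<open>alternating_facet_sum\<close>). Evaluated on the list of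
  relabelled vertices of a simplex, the alternating sum is \<open>\<Omega>\<close> of the boundary, and the signed
  set expression is the boundary of \<open>\<Omega>\<close> of the simplex.
\<close>

section \<open>Signs of lists and inversions\<close>

fun inversions :: "nat list \<Rightarrow> nat" where
  "inversions [] = 0"
| "inversions (x # xs) = length (filter (\<lambda>y. y < x) xs) + inversions xs"

lemma inversions_remove:
  "inversions (as @ x # bs) =
     inversions (as @ bs) + length (filter (\<lambda>y. x < y) as) + length (filter (\<lambda>y. y < x) bs)"
  by (induction as) auto

lemma inversions_sorted: "sorted xs \<Longrightarrow> inversions xs = 0"
  by (induction xs) (auto simp: filter_empty_conv not_less)

lemma inversions_swap_descent:
  "y < x \<Longrightarrow> inversions (as @ x # y # bs) = Suc (inversions (as @ y # x # bs))"
  by (induction as) auto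

lemma unsorted_has_descent:
  fixes xs :: "'a::linorder list"
  assumes "\<not> sorted xs"
  obtains as x y bs where "xs = as @ x # y # bs" and "y < x"
proof -
  obtain i where i: "Suc i < length xs" "xs ! Suc i < xs ! i"
    using assms by (auto simp: sorted_iff_nth_Suc not_le)
  have "xs = take i xs @ xs ! i # xs ! Suc i # drop (Suc (Suc i)) xs"
    using i(1) by (simp add: Cons_nth_drop_Suc)
  then show thesis using i(2) that by blast
qed

lemma permute_list_adjacent_transpose:
  "permute_list (transpose (length as) (Suc (length as))) (as @ x # y # bs) = as @ y # x # bs"
  (is "permute_list ?t ?xs = ?ys")
proof (rule nth_equalityI)
  have t: "?t permutes {..<length ?xs}"
    by (rule permutes_swap_id) auto
  show "permute_list ?t ?xs ! i = ?ys ! i" if "i < length (permute_list ?t ?xs)" for i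
    using that permute_list_nth[OF t, of i]
    by (auto simp: transpose_def nth_append nth_Cons split: nat.splits if_splits)
qed simp

text \<open>
  Exchanging the two entries of an adjacent descent removes exactly one inversion and composes the
  sorting permutation with one transposition, so both sides of the sign equation change together
  until the list is sorted.
\<close>

lemma sorting_permutation_sign:
  "\<exists>p. p permutes {..<length xs} \<and> permute_list p xs = sort xs \<and> sign p = (-1) ^ inversions xs"
proof (induction "inversions xs" arbitrary: xs rule: less_induct)
  case less
  show ?case
  proof (cases "sorted xs")
    case True
    then show ?thesis
      by (intro exI[of _ id]) (auto simp: inversions_sorted permutes_id sorted_sort_id)
  next
    case False
    then obtain as x y bs where xs: "xs = as @ x # y # bs" and "y < x"
      by (rule unsorted_has_descent)
    define ys where "ys = as @ y # x # bs"
    define t where "t = transpose (length as) (Suc (length as))"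
    have inv: "inversions xs = Suc (inversions ys)"
      unfolding xs ys_def using \<open>y < x\<close> by (rule inversions_swap_descent)
    have len: "length ys = length xs" by (simp add: xs ys_def)
    have t: "t permutes {..<length xs}"
      unfolding t_def by (rule permutes_swap_id) (auto simp: xs)
    have txs: "permute_list t xs = ys"
      unfolding t_def xs ys_def by (rule permute_list_adjacent_transpose)
    obtain p where p: "p permutes {..<length xs}" "permute_list p ys = sort ys"
      "sign p = (-1) ^ inversions ys"
      using less[of ys] inv len by auto
    have "sort ys = sort xs"
      by (rule properties_for_sort) (auto simp: xs ys_def)
    then have "permute_list (t \<circ> p) xs = sort xs"
      using permute_list_compose[OF p(1)] txs p(2) by simp
    moreover have "sign (t \<circ> p) = (-1) ^ inversions xs"
      using sign_compose[of t p] t p permutation_permutes[of t] permutation_permutes[of p] inv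
      by (auto simp: t_def sign_swap_id)
    ultimately show ?thesis
      using permutes_compose[OF p(1) t] by blast
  qed
qed

text \<open>
  On a list of distinct entries the sorting permutation is unique, so the definite description in
  \<^const>\<open>list_sign\<close> denotes the permutation found above.
\<close>

lemma list_sign_inversions:
  assumes "distinct xs"
  shows "list_sign xs = (-1) ^ inversions xs"
proof -
  obtain p where p: "p permutes {..<length xs}" "permute_list p xs = sort xs"
    "sign p = (-1) ^ inversions xs"
    using sorting_permutation_sign by blast
  have "q = p" if q: "q permutes {..<length xs}" "permute_list q xs = sort xs" for q
  proof
    fix i
    show "q i = p i"
    proof (cases "i < length xs")
      case True
      then have "xs ! q i = xs ! p i"
        using p q permute_list_nth by metis
      moreover have "q i < length xs" "p i < length xs"
        using True permutes_in_image[OF q(1)] permutes_in_image[OF p(1)] by auto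
      ultimately show ?thesis
        using assms nth_eq_iff_index_eq by blast
    next
      case False
      then show ?thesis
        using permutes_not_in[OF q(1)] permutes_not_in[OF p(1)] by simp
    qed
  qed
  with p(1,2) have "(THE p. p permutes {..<length xs} \<and> permute_list p xs = sort xs) = p"
    by (intro the_equality) blast+
  then show ?thesis
    by (simp add: list_sign_def p(3))
qed

lemma list_sign_sorted: "sorted xs \<Longrightarrow> distinct xs \<Longrightarrow> list_sign xs = 1"
  by (simp add: list_sign_inversions inversions_sorted)

lemma list_sign_square: "distinct xs \<Longrightarrow> list_sign xs * list_sign xs = 1"
  by (simp add: list_sign_inversions flip: power_add)

text \<open>
  The inversions involving \<open>x\<close> are the larger entries before it and the smaller entries after it.
  The rank of \<open>x\<close> counts the smaller entries on both sides. In the sum of the two numbers the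
  smaller entries after \<open>x\<close> occur twice, and what remains is all entries before \<open>x\<close>, that is, the
  position of \<open>x\<close>.
\<close>

lemma list_sign_remove:
  assumes "distinct (as @ x # bs)"
  shows "(-1) ^ length as * list_sign (as @ bs) =
         list_sign (as @ x # bs) * (-1) ^ card {y \<in> set (as @ x # bs). y < x}"
proof -
  have "card {y \<in> set (as @ x # bs). y < x} = card (set (filter (\<lambda>y. y < x) (as @ bs)))"
    by (rule arg_cong[where f = card]) auto
  also have "\<dots> = length (filter (\<lambda>y. y < x) (as @ bs))"
    using assms by (intro distinct_card) auto
  finally have card: "card {y \<in> set (as @ x # bs). y < x} =
      length (filter (\<lambda>y. y < x) as) + length (filter (\<lambda>y. y < x) bs)"
    by simp
  have "length as = length (filter (\<lambda>y. y < x) as) + length (filter (\<lambda>y. \<not> y < x) as)"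
    by (simp add: sum_length_filter_compl)
  also have "filter (\<lambda>y. \<not> y < x) as = filter (\<lambda>y. x < y) as"
    using assms by (intro filter_cong) auto
  finally have "inversions (as @ x # bs) + card {y \<in> set (as @ x # bs). y < x} =
      length as + inversions (as @ bs) + 2 * length (filter (\<lambda>y. y < x) bs)"
    using card inversions_remove[of as x bs] by linarith
  then have "(-1::int) ^ (inversions (as @ x # bs) + card {y \<in> set (as @ x # bs). y < x}) =
      (-1) ^ (length as + inversions (as @ bs))"
    by (simp only: power_add) simp
  then show ?thesis
    using assms by (simp add: list_sign_inversions power_add)
qed


section \<open>The boundary of a simplex\<close>

text \<open>
  The alternating sum over the facets of a simplex with vertex indices \<open>I\<close>, with the position of a
  vertex replaced by its rank in \<open>I\<close>. No listing of \<open>I\<close> enters, which is what makes the boundaries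
  with respect to different vertex orders comparable.
\<close>

definition facet_sum :: "(nat \<Rightarrow> 'v) \<Rightarrow> nat set \<Rightarrow> ('v set \<Rightarrow>\<^sub>0 real)" where
  "facet_sum v I =
     (\<Sum>i\<in>I. (-1) ^ card {k \<in> I. k < i} *\<^sub>R Poly_Mapping.single (v ` (I - {i})) 1)"

text \<open>
  By \<open>list_sign_remove\<close>, the sign \<open>(-1) ^ j\<close> together with the sign of the shortened list equals
  the sign of the whole list times the sign of the rank of the removed entry. The first factor is
  common to all terms, and the second depends on the entry alone, so the sum can be taken over
  entries instead of positions.
\<close>

lemma alternating_facet_sum:
  assumes "distinct xs"
  shows "(\<Sum>j<length xs. (-1) ^ j *\<^sub>R oriented_simplex v (take j xs @ drop (Suc j) xs)) =
         of_int (list_sign xs) *\<^sub>R facet_sum v (set xs)"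
proof -
  let ?r = "\<lambda>i. (-1) ^ card {k \<in> set xs. k < i} *\<^sub>R
      Poly_Mapping.single (v ` (set xs - {i})) (1::real)"
  have "(-1) ^ j *\<^sub>R oriented_simplex v (take j xs @ drop (Suc j) xs) =
      of_int (list_sign xs) *\<^sub>R ?r (xs ! j)" if "j < length xs" for j
  proof -
    let ?as = "take j xs" and ?x = "xs ! j" and ?bs = "drop (Suc j) xs"
    have xs: "xs = ?as @ ?x # ?bs"
      using that by (rule id_take_nth_drop)
    have dist: "distinct (?as @ ?x # ?bs)"
      using assms xs by simp
    then have set: "set (?as @ ?bs) = set xs - {?x}"
      using arg_cong[OF xs, of set] by auto
    have "(-1) ^ j * list_sign (?as @ ?bs) = list_sign xs * (-1) ^ card {k \<in> set xs. k < ?x}"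
      using list_sign_remove[OF dist] xs that by simp
    then have "real_of_int ((-1) ^ j * list_sign (?as @ ?bs)) =
        real_of_int (list_sign xs * (-1) ^ card {k \<in> set xs. k < ?x})"
      by (rule arg_cong)
    then show ?thesis
      by (simp add: oriented_simplex_def set del: set_append)
  qed
  then have "(\<Sum>j<length xs. (-1) ^ j *\<^sub>R oriented_simplex v (take j xs @ drop (Suc j) xs)) =
      (\<Sum>j<length xs. of_int (list_sign xs) *\<^sub>R ?r (xs ! j))"
    by (intro sum.cong) auto
  also have "\<dots> = (\<Sum>i\<in>set xs. of_int (list_sign xs) *\<^sub>R ?r i)"
    using bij_betw_nth[OF assms refl refl]
    by (rule sum.reindex_bij_betw)
  finally show ?thesis
    by (simp add: facet_sum_def scaleR_sum_right)
qed


section \<open>Linear extension\<close>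

definition linear_extension :: "('a \<Rightarrow> 'b::real_vector) \<Rightarrow> ('a \<Rightarrow>\<^sub>0 real) \<Rightarrow> 'b" where
  "linear_extension f c = (\<Sum>x\<in>Poly_Mapping.keys c. Poly_Mapping.lookup c x *\<^sub>R f x)"

lemma lookup_scaleR:
  "Poly_Mapping.lookup (r *\<^sub>R c) x = r *\<^sub>R Poly_Mapping.lookup c x"
proof -
  have "{x. r *\<^sub>R Poly_Mapping.lookup c x \<noteq> 0} \<subseteq> Poly_Mapping.keys c"
    by (auto simp: in_keys_iff)
  then have "finite {x. r *\<^sub>R Poly_Mapping.lookup c x \<noteq> 0}"
    using finite_keys finite_subset by blast
  then show ?thesis
    by (simp add: scaleR_poly_mapping_def)
qed

lemma linear_extension_superset:
  assumes "finite A" "Poly_Mapping.keys c \<subseteq> A"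
  shows "linear_extension f c = (\<Sum>x\<in>A. Poly_Mapping.lookup c x *\<^sub>R f x)"
  unfolding linear_extension_def using assms
  by (intro sum.mono_neutral_left) (auto simp: in_keys_iff)

lemma linear_linear_extension: "linear (linear_extension f)"
proof
  fix c d :: "'a \<Rightarrow>\<^sub>0 real"
  let ?A = "Poly_Mapping.keys c \<union> Poly_Mapping.keys d"
  have "linear_extension f (c + d) = (\<Sum>x\<in>?A. Poly_Mapping.lookup (c + d) x *\<^sub>R f x)"
    using keys_add[of c d] by (intro linear_extension_superset) auto
  also have "\<dots> = linear_extension f c + linear_extension f d"
    by (simp add: lookup_add scaleR_add_left sum.distrib linear_extension_superset[of ?A])
  finally show "linear_extension f (c + d) = linear_extension f c + linear_extension f d" .
next
  fix r :: real and c :: "'a \<Rightarrow>\<^sub>0 real"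
  have "linear_extension f (r *\<^sub>R c) =
      (\<Sum>x\<in>Poly_Mapping.keys c. Poly_Mapping.lookup (r *\<^sub>R c) x *\<^sub>R f x)"
    by (intro linear_extension_superset) (auto simp: in_keys_iff lookup_scaleR)
  then show "linear_extension f (r *\<^sub>R c) = r *\<^sub>R linear_extension f c"
    by (simp add: lookup_scaleR linear_extension_def scaleR_sum_right)
qed

lemma linear_extension_single [simp]: "linear_extension f (Poly_Mapping.single x 1) = f x"
  by (simp add: linear_extension_def)

lemma linear_compose_linear_extension:
  "linear g \<Longrightarrow> g (linear_extension f c) = linear_extension (\<lambda>x. g (f x)) c"
  by (simp add: linear_extension_def linear_sum linear_scale)

lemma linear_extension_cong:
  "(\<And>x. x \<in> Poly_Mapping.keys c \<Longrightarrow> f x = g x) \<Longrightarrow> linear_extension f c = linear_extension g c"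
  by (simp add: linear_extension_def)

lemma lookup_linear_extension:
  "Poly_Mapping.lookup (linear_extension f c) y =
     (\<Sum>x\<in>Poly_Mapping.keys c. Poly_Mapping.lookup c x * Poly_Mapping.lookup (f x) y)"
  for f :: "'a \<Rightarrow> ('b \<Rightarrow>\<^sub>0 real)"
  by (simp add: linear_extension_def lookup_sum lookup_scaleR)

lemma linear_extension_basis: "linear_extension (\<lambda>x. Poly_Mapping.single x 1) c = c"
  by (rule poly_mapping_eqI)
    (simp add: lookup_linear_extension lookup_single when_def in_keys_iff if_distrib cong: if_cong)

lemma subspace_chains_on: "subspace {c :: 'a \<Rightarrow>\<^sub>0 real. Poly_Mapping.keys c \<subseteq> A}"
proof (rule subspaceI)
  fix c d :: "'a \<Rightarrow>\<^sub>0 real"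
  assume "c \<in> {c. Poly_Mapping.keys c \<subseteq> A}" "d \<in> {c. Poly_Mapping.keys c \<subseteq> A}"
  then show "c + d \<in> {c. Poly_Mapping.keys c \<subseteq> A}"
    using keys_add[of c d] by blast
qed (auto simp: in_keys_iff lookup_scaleR)

lemma subspace_chains: "subspace (chains L \<rho>)"
  unfolding chains_def by (rule subspace_chains_on)

lemma linear_image_sum_sets:
  fixes M :: "'i \<Rightarrow> 'a::real_vector set"
  assumes f: "linear f"
  shows "f ` (\<Sum>i\<in>T. M i) = (\<Sum>i\<in>T. f ` M i)"
proof -
  have "f ` A + f ` B = f ` (A + B)" for A B
    by (force simp: set_plus_def linear_add[OF f])
  then show ?thesis
    using sum_set_linear[of "image f" M T] by (simp add: linear_0[OF f] comp_def)
qed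

lemma sum_sets_subset_subspace:
  fixes M :: "'i \<Rightarrow> 'a::real_vector set"
  assumes "subspace S" "\<And>i. i \<in> T \<Longrightarrow> M i \<subseteq> S"
  shows "(\<Sum>i\<in>T. M i) \<subseteq> S"
  using assms(2)
  by (induction T rule: infinite_finite_induct)
    (use assms(1) in \<open>auto simp: subspace_0 set_plus_def intro!: subspace_add\<close>)

lemma Omega_eq_linear_extension:
  "Omega v w m \<xi> = linear_extension (\<lambda>\<sigma>. oriented_simplex w (map \<xi> (vertex_indices v m \<sigma>)))"
  by (simp add: fun_eq_iff Omega_def linear_extension_def)

lemma linear_Omega: "linear (Omega v w m \<xi>)"
  by (simp add: Omega_eq_linear_extension linear_linear_extension)

lemma boundary_eq_linear_extension:
  "\<rho> \<noteq> 0 \<Longrightarrow> boundary v m \<rho> = linear_extension (\<lambda>\<sigma>. \<Sum>j\<le>\<rho>. (-1) ^ j *\<^sub>R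
     oriented_simplex v (take j (vertex_indices v m \<sigma>) @ drop (Suc j) (vertex_indices v m \<sigma>)))"
  by (simp add: fun_eq_iff boundary_def linear_extension_def)

lemma linear_boundary: "linear (boundary v m \<rho>)"
proof (cases "\<rho> = 0")
  case True
  then have "boundary v m \<rho> = (\<lambda>c. 0)"
    by (simp add: fun_eq_iff boundary_def)
  then show ?thesis
    by (simp add: linear_zero)
qed (simp add: boundary_eq_linear_extension linear_linear_extension)

lemma vertex_indices_image:
  assumes "inj_on v {1..m}" "I \<subseteq> {1..m}"
  shows "vertex_indices v m (v ` I) = sorted_list_of_set I"
proof -
  have "{i \<in> {1..m}. v i \<in> v ` I} = I"
    using assms by (auto dest: inj_onD)
  then show ?thesis
    by (simp add: vertex_indices_def)
qed

lemma boundary_single: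
  assumes "inj_on v {1..m}" "I \<subseteq> {1..m}" "card I = Suc \<rho>" "\<rho> \<noteq> 0"
  shows "boundary v m \<rho> (Poly_Mapping.single (v ` I) 1) = facet_sum v I"
proof -
  let ?xs = "sorted_list_of_set I"
  have "finite I"
    using assms(2) finite_subset by blast
  then have "(\<Sum>j<length ?xs. (-1) ^ j *\<^sub>R oriented_simplex v (take j ?xs @ drop (Suc j) ?xs)) =
      facet_sum v I"
    by (simp add: alternating_facet_sum list_sign_sorted del: length_sorted_list_of_set)
  then show ?thesis
    using assms
    by (simp add: boundary_eq_linear_extension vertex_indices_image lessThan_Suc_atMost)
qed

lemma Omega_single:
  assumes "inj_on v {1..m}" "I \<subseteq> {1..m}"
  shows "Omega v w m \<xi> (Poly_Mapping.single (v ` I) 1) =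
         oriented_simplex w (map \<xi> (sorted_list_of_set I))"
  by (simp add: Omega_eq_linear_extension vertex_indices_image[OF assms])

lemma sorted_distinct_remove_nth:
  fixes xs :: "'a::linorder list"
  assumes "sorted xs" "distinct xs" "j < length xs"
  shows "sorted (take j xs @ drop (Suc j) xs)" "distinct (take j xs @ drop (Suc j) xs)"
proof -
  have "sorted (take j xs @ xs ! j # drop (Suc j) xs)" "distinct (take j xs @ xs ! j # drop (Suc j) xs)"
    using assms by (simp_all only: id_take_nth_drop[OF assms(3), symmetric])
  then show "sorted (take j xs @ drop (Suc j) xs)" "distinct (take j xs @ drop (Suc j) xs)"
    unfolding sorted_append distinct_append by simp_all
qed

lemma Omega_oriented_simplex_sorted:
  assumes "inj_on v {1..m}" "set xs \<subseteq> {1..m}" "sorted xs" "distinct xs"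
  shows "Omega v w m \<xi> (oriented_simplex v xs) = oriented_simplex w (map \<xi> xs)"
  using Omega_single[OF assms(1,2)] assms(3,4)
  by (simp add: oriented_simplex_def list_sign_sorted sorted_list_of_set_sort_remdups
      sorted_sort_id distinct_remdups_id)


section \<open>Relabelling chains\<close>

locale relabelling =
  fixes v :: "nat \<Rightarrow> 'v" and w :: "nat \<Rightarrow> 'w" and m :: nat and \<xi> :: "nat \<Rightarrow> nat"
  assumes inj_v: "inj_on v {1..m}" and inj_w: "inj_on w {1..m}" and perm: "\<xi> permutes {1..m}"
begin

text \<open>
  Elements of \<open>\<sigma>\<close> other than \<open>v 1, \<dots>, v m\<close> are ignored, exactly as in \<^const>\<open>vertex_indices\<close>, so that
  \<open>\<Omega>\<close> is a signed relabelling of simplices on all chains (\<open>Omega_eq_signed_relabelling\<close>).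
\<close>

definition relabel_simplex :: "'v set \<Rightarrow> 'w set" where
  "relabel_simplex \<sigma> = w ` \<xi> ` {i \<in> {1..m}. v i \<in> \<sigma>}"

definition relabel_sign :: "'v set \<Rightarrow> real" where
  "relabel_sign \<sigma> = of_int (list_sign (map \<xi> (vertex_indices v m \<sigma>)))"

text \<open>
  A common ambient space for the chains of all subcomplexes in all degrees. As \<open>\<Omega>\<close> ignores elements
  other than \<open>v 1, \<dots>, v m\<close>, it is injective here but need not be on larger spaces.
\<close>

abbreviation "chains_on_vertices \<equiv> {c :: 'v set \<Rightarrow>\<^sub>0 real.
    Poly_Mapping.keys c \<subseteq> Pow (v ` {1..m})}"

lemma index_set:
  assumes "\<sigma> \<subseteq> v ` {1..m}"
  obtains I where "I \<subseteq> {1..m}" "\<sigma> = v ` I"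
  using assms by (auto simp: subset_image_iff)

lemma inj_on_relabelled_vertices: "inj_on (w \<circ> \<xi>) {1..m}"
  using inj_w perm by (intro comp_inj_on) (auto simp: permutes_inj_on permutes_image)

lemma relabel_simplex_image:
  assumes "I \<subseteq> {1..m}"
  shows "relabel_simplex (v ` I) = w ` \<xi> ` I"
proof -
  have "{i \<in> {1..m}. v i \<in> v ` I} = I"
    using assms inj_v by (auto dest: inj_onD)
  then show ?thesis
    by (simp add: relabel_simplex_def)
qed

lemma card_relabel_simplex:
  assumes "\<sigma> \<subseteq> v ` {1..m}"
  shows "card (relabel_simplex \<sigma>) = card \<sigma>"
proof -
  obtain I where I: "I \<subseteq> {1..m}" "\<sigma> = v ` I"
    using assms by (rule index_set)
  then have "card (relabel_simplex \<sigma>) = card ((w \<circ> \<xi>) ` I)"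
    by (simp add: relabel_simplex_image image_comp)
  also have "\<dots> = card I"
    using inj_on_relabelled_vertices I(1) by (meson card_image inj_on_subset)
  also have "\<dots> = card \<sigma>"
    using inj_v I by (metis card_image inj_on_subset)
  finally show ?thesis .
qed

lemma inj_on_relabel_simplex: "inj_on relabel_simplex (Pow (v ` {1..m}))"
proof
  fix \<sigma> \<tau>
  assume "\<sigma> \<in> Pow (v ` {1..m})" "\<tau> \<in> Pow (v ` {1..m})"
    and eq: "relabel_simplex \<sigma> = relabel_simplex \<tau>"
  then obtain I J where IJ: "I \<subseteq> {1..m}" "\<sigma> = v ` I" "J \<subseteq> {1..m}" "\<tau> = v ` J"
    by (metis PowD index_set)
  then have "(w \<circ> \<xi>) ` I = (w \<circ> \<xi>) ` J"
    using eq by (simp add: relabel_simplex_image image_comp)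
  then have "I = J"
    using inj_on_image_eq_iff[OF inj_on_relabelled_vertices] IJ by blast
  then show "\<sigma> = \<tau>"
    using IJ by simp
qed

lemma relabel_eq_image:
  assumes "L \<subseteq> Pow (v ` {1..m})"
  shows "relabel v w m \<xi> L = relabel_simplex ` L"
proof (intro equalityI subsetI)
  fix \<tau>
  assume "\<tau> \<in> relabel v w m \<xi> L"
  then show "\<tau> \<in> relabel_simplex ` L"
    by (auto simp: relabel_def simp flip: relabel_simplex_image)
next
  fix \<tau>
  assume "\<tau> \<in> relabel_simplex ` L"
  then obtain \<sigma> where "\<sigma> \<in> L" and \<tau>: "\<tau> = relabel_simplex \<sigma>"
    by blast
  then obtain I where "I \<subseteq> {1..m}" "\<sigma> = v ` I"
    using assms by (meson PowD index_set subsetD)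
  then show "\<tau> \<in> relabel v w m \<xi> L"
    using \<open>\<sigma> \<in> L\<close> \<tau> by (auto simp: relabel_def relabel_simplex_image)
qed

lemma simplices_relabel:
  assumes "L \<subseteq> Pow (v ` {1..m})"
  shows "simplices (relabel v w m \<xi> L) \<rho> = relabel_simplex ` simplices L \<rho>"
  using assms card_relabel_simplex by (auto simp: simplices_def relabel_eq_image)

lemma distinct_relabelled_indices: "distinct xs \<Longrightarrow> distinct (map \<xi> xs)"
  using permutes_inj_on[OF perm] by (simp add: distinct_map)

lemma relabel_sign_square: "relabel_sign \<sigma> * relabel_sign \<sigma> = 1"
proof -
  have "distinct (map \<xi> (vertex_indices v m \<sigma>))"
    by (intro distinct_relabelled_indices) (simp add: vertex_indices_def)
  then show ?thesis
    unfolding relabel_sign_def by (metis list_sign_square of_int_1 of_int_mult)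
qed

lemma Omega_eq_signed_relabelling:
  "Omega v w m \<xi> =
     linear_extension (\<lambda>\<sigma>. relabel_sign \<sigma> *\<^sub>R Poly_Mapping.single (relabel_simplex \<sigma>) 1)"
  by (simp add: Omega_eq_linear_extension oriented_simplex_def relabel_sign_def relabel_simplex_def
      vertex_indices_def)

text \<open>
  In coordinates \<open>\<Omega>\<close> is a signed permutation. Injectivity and the isometry property are both read
  off from this equation.
\<close>

lemma lookup_Omega:
  assumes "c \<in> chains_on_vertices" "\<sigma> \<subseteq> v ` {1..m}"
  shows "Poly_Mapping.lookup (Omega v w m \<xi> c) (relabel_simplex \<sigma>) =
         relabel_sign \<sigma> * Poly_Mapping.lookup c \<sigma>"
proof -
  have "relabel_simplex \<tau> = relabel_simplex \<sigma> \<longleftrightarrow> \<tau> = \<sigma>" if "\<tau> \<in> Poly_Mapping.keys c" for \<tau>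
    using that assms inj_on_eq_iff[OF inj_on_relabel_simplex, of \<tau> \<sigma>] by blast
  then have "Poly_Mapping.lookup (Omega v w m \<xi> c) (relabel_simplex \<sigma>) =
      (\<Sum>\<tau>\<in>Poly_Mapping.keys c.
         if \<tau> = \<sigma> then Poly_Mapping.lookup c \<sigma> * relabel_sign \<sigma> else 0)"
    unfolding Omega_eq_signed_relabelling lookup_linear_extension
    by (intro sum.cong) (auto simp: lookup_scaleR lookup_single when_def)
  then show ?thesis
    by (simp add: in_keys_iff)
qed

lemma keys_Omega:
  "Poly_Mapping.keys (Omega v w m \<xi> c) \<subseteq> relabel_simplex ` Poly_Mapping.keys c"
proof
  fix \<tau>
  assume "\<tau> \<in> Poly_Mapping.keys (Omega v w m \<xi> c)"
  then have "Poly_Mapping.lookup (Omega v w m \<xi> c) \<tau> \<noteq> 0"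
    by (simp add: in_keys_iff)
  then obtain \<sigma> where "\<sigma> \<in> Poly_Mapping.keys c"
      "Poly_Mapping.lookup (Poly_Mapping.single (relabel_simplex \<sigma>) (1::real)) \<tau> \<noteq> 0"
    unfolding Omega_eq_signed_relabelling lookup_linear_extension lookup_scaleR
    by (metis (no_types, lifting) mult_zero_right real_scaleR_def sum.neutral)
  then show "\<tau> \<in> relabel_simplex ` Poly_Mapping.keys c"
    by (auto simp: lookup_single when_def split: if_splits)
qed

lemma inj_on_Omega: "inj_on (Omega v w m \<xi>) chains_on_vertices"
proof
  fix c d
  assume c: "c \<in> chains_on_vertices" and d: "d \<in> chains_on_vertices"
    and eq: "Omega v w m \<xi> c = Omega v w m \<xi> d"
  show "c = d"
  proof (rule poly_mapping_eqI)
    fix \<sigma>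
    show "Poly_Mapping.lookup c \<sigma> = Poly_Mapping.lookup d \<sigma>"
    proof (cases "\<sigma> \<subseteq> v ` {1..m}")
      case True
      then have "relabel_sign \<sigma> * Poly_Mapping.lookup c \<sigma> = relabel_sign \<sigma> * Poly_Mapping.lookup d \<sigma>"
        using lookup_Omega[OF c] lookup_Omega[OF d] eq by metis
      then show ?thesis
        using relabel_sign_square[of \<sigma>] by auto
    next
      case False
      then have "\<sigma> \<notin> Poly_Mapping.keys c" "\<sigma> \<notin> Poly_Mapping.keys d"
        using c d by auto
      then show ?thesis
        by (simp add: in_keys_iff)
    qed
  qed
qed

lemma chains_subset_chains_on_vertices:
  "L \<subseteq> Pow (v ` {1..m}) \<Longrightarrow> chains L \<rho> \<subseteq> chains_on_vertices"
  by (auto simp: chains_def simplices_def)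

text \<open>
  For surjectivity it suffices to reach the basis elements of the target, because the image of a
  subspace is a subspace. The basis element at \<open>\<xi>(\<sigma>)\<close> is the image of the one at \<open>\<sigma>\<close> up to a sign,
  which is its own inverse.
\<close>

lemma Omega_image_chains:
  assumes L: "L \<subseteq> Pow (v ` {1..m})"
  shows "Omega v w m \<xi> ` chains L \<rho> = chains (relabel v w m \<xi> L) \<rho>"
proof (intro equalityI subsetI)
  fix d
  assume "d \<in> Omega v w m \<xi> ` chains L \<rho>"
  then obtain c where "Poly_Mapping.keys c \<subseteq> simplices L \<rho>" "d = Omega v w m \<xi> c"
    by (auto simp: chains_def)
  then show "d \<in> chains (relabel v w m \<xi> L) \<rho>"
    using keys_Omega[of c] by (fastforce simp: chains_def simplices_relabel[OF L])
next
  fix d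
  assume "d \<in> chains (relabel v w m \<xi> L) \<rho>"
  then have d: "Poly_Mapping.keys d \<subseteq> relabel_simplex ` simplices L \<rho>"
    by (simp add: chains_def simplices_relabel[OF L])
  have basis: "Poly_Mapping.single \<tau> 1 \<in> Omega v w m \<xi> ` chains L \<rho>"
    if \<tau>: "\<tau> \<in> relabel_simplex ` simplices L \<rho>" for \<tau>
  proof -
    from \<tau> obtain \<sigma> where \<sigma>: "\<sigma> \<in> simplices L \<rho>" "\<tau> = relabel_simplex \<sigma>"
      by blast
    let ?c = "relabel_sign \<sigma> *\<^sub>R Poly_Mapping.single \<sigma> (1::real)"
    have "Omega v w m \<xi> ?c = Poly_Mapping.single \<tau> 1"
      using \<sigma>(2) by (simp add: linear_scale[OF linear_Omega] relabel_sign_square)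
        (simp add: Omega_eq_signed_relabelling relabel_sign_square)
    moreover have "?c \<in> chains L \<rho>"
      using \<sigma>(1) by (auto simp: chains_def in_keys_iff lookup_scaleR lookup_single when_def split: if_splits)
    ultimately show ?thesis
      by (metis imageI)
  qed
  have "d = linear_extension (\<lambda>\<tau>. Poly_Mapping.single \<tau> 1) d"
    by (rule linear_extension_basis[symmetric])
  also have "\<dots> \<in> Omega v w m \<xi> ` chains L \<rho>"
    unfolding linear_extension_def
    using d basis
    by (intro subspace_sum subspace_scale linear_subspace_image linear_Omega subspace_chains) auto
  finally show "d \<in> Omega v w m \<xi> ` chains L \<rho>" .
qed

lemma chain_inner_Omega:
  assumes K: "K \<subseteq> Pow (v ` {1..m})"
    and "c \<in> chains_on_vertices" "d \<in> chains_on_vertices"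
  shows "chain_inner (relabel v w m \<xi> K) \<rho> (Omega v w m \<xi> c) (Omega v w m \<xi> d) =
         chain_inner K \<rho> c d"
proof -
  have sub: "simplices K \<rho> \<subseteq> Pow (v ` {1..m})"
    using K by (auto simp: simplices_def)
  have "chain_inner (relabel v w m \<xi> K) \<rho> (Omega v w m \<xi> c) (Omega v w m \<xi> d) =
      (\<Sum>\<sigma>\<in>simplices K \<rho>.
         (relabel_sign \<sigma> * Poly_Mapping.lookup c \<sigma>) * (relabel_sign \<sigma> * Poly_Mapping.lookup d \<sigma>))"
    unfolding chain_inner_def simplices_relabel[OF K]
    using sub assms lookup_Omega
    by (subst sum.reindex[OF inj_on_subset[OF inj_on_relabel_simplex sub]])
      (intro sum.cong, auto)
  also have "\<dots> = (\<Sum>\<sigma>\<in>simplices K \<rho>. (relabel_sign \<sigma> * relabel_sign \<sigma>) *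
         (Poly_Mapping.lookup c \<sigma> * Poly_Mapping.lookup d \<sigma>))"
    by (simp only: ac_simps)
  finally show ?thesis
    by (simp add: relabel_sign_square chain_inner_def)
qed

text \<open>
  Let \<open>i\<^sub>0 < \<dots> < i\<^sub>\<rho>\<close> be the elements of \<open>I\<close>. Both sides are evaluated on the generally unsorted list
  \<open>\<xi> i\<^sub>0, \<dots>, \<xi> i\<^sub>\<rho>\<close>: the left side is its sign times the facet sum of \<open>\<xi> ` I\<close>, the right side is
  the alternating sum over its entries.
\<close>

lemma boundary_Omega_single:
  assumes I: "I \<subseteq> {1..m}" "card I = Suc \<rho>" and "\<rho> \<noteq> 0"
  shows "boundary w m \<rho> (Omega v w m \<xi> (Poly_Mapping.single (v ` I) 1)) =
         Omega v w m \<xi> (boundary v m \<rho> (Poly_Mapping.single (v ` I) 1))"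
proof -
  let ?xs = "sorted_list_of_set I"
  have fin: "finite I"
    using I(1) finite_subset by blast
  have len: "length ?xs = Suc \<rho>"
    using I(2) by simp
  have \<xi>I: "\<xi> ` I \<subseteq> {1..m}" "card (\<xi> ` I) = Suc \<rho>"
    using I permutes_image[OF perm] by (auto simp: card_image permutes_inj_on[OF perm])
  have dist: "distinct (map \<xi> ?xs)"
    by (intro distinct_relabelled_indices) simp
  have "boundary w m \<rho> (Omega v w m \<xi> (Poly_Mapping.single (v ` I) 1)) =
      of_int (list_sign (map \<xi> ?xs)) *\<^sub>R boundary w m \<rho> (Poly_Mapping.single (w ` \<xi> ` I) 1)"
    using fin by (simp add: Omega_single[OF inj_v I(1)] oriented_simplex_def
        linear_scale[OF linear_boundary])
  also have "\<dots> = of_int (list_sign (map \<xi> ?xs)) *\<^sub>R facet_sum w (set (map \<xi> ?xs))"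
    using fin by (simp add: boundary_single[OF inj_w \<xi>I \<open>\<rho> \<noteq> 0\<close>])
  also have "\<dots> = (\<Sum>j<length (map \<xi> ?xs). (-1) ^ j *\<^sub>R
      oriented_simplex w (take j (map \<xi> ?xs) @ drop (Suc j) (map \<xi> ?xs)))"
    by (rule alternating_facet_sum[OF dist, symmetric])
  also have "\<dots> = (\<Sum>j\<le>\<rho>. (-1) ^ j *\<^sub>R
      Omega v w m \<xi> (oriented_simplex v (take j ?xs @ drop (Suc j) ?xs)))"
  proof (rule sum.cong)
    fix j assume "j \<in> {..\<rho>}"
    then have j: "j < length ?xs"
      using len by simp
    have "set (take j ?xs @ drop (Suc j) ?xs) \<subseteq> {1..m}"
      using fin I(1) set_take_subset[of j ?xs] set_drop_subset[of "Suc j" ?xs] by auto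
    moreover have "sorted (take j ?xs @ drop (Suc j) ?xs)" "distinct (take j ?xs @ drop (Suc j) ?xs)"
      using sorted_distinct_remove_nth[OF sorted_sorted_list_of_set distinct_sorted_list_of_set j]
      by blast+
    ultimately show "(-1) ^ j *\<^sub>R oriented_simplex w (take j (map \<xi> ?xs) @ drop (Suc j) (map \<xi> ?xs)) =
        (-1) ^ j *\<^sub>R Omega v w m \<xi> (oriented_simplex v (take j ?xs @ drop (Suc j) ?xs))"
      by (simp add: Omega_oriented_simplex_sorted[OF inj_v] take_map drop_map)
  qed (use len in auto)
  also have "\<dots> = Omega v w m \<xi> (boundary v m \<rho> (Poly_Mapping.single (v ` I) 1))"
    using \<open>\<rho> \<noteq> 0\<close> by (simp add: boundary_eq_linear_extension vertex_indices_image[OF inj_v I(1)]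
        linear_sum[OF linear_Omega] linear_scale[OF linear_Omega])
  finally show ?thesis .
qed

lemma boundary_Omega:
  assumes L: "L \<subseteq> Pow (v ` {1..m})" and c: "c \<in> chains L \<rho>"
  shows "boundary w m \<rho> (Omega v w m \<xi> c) = Omega v w m \<xi> (boundary v m \<rho> c)"
proof (cases "\<rho> = 0")
  case True
  then show ?thesis
    by (simp add: boundary_def linear_0[OF linear_Omega])
next
  case False
  let ?e = "\<lambda>\<sigma>. Poly_Mapping.single \<sigma> (1::real)"
  have c_basis: "c = linear_extension ?e c"
    by (rule linear_extension_basis[symmetric])
  have "boundary w m \<rho> (Omega v w m \<xi> (?e \<sigma>)) = Omega v w m \<xi> (boundary v m \<rho> (?e \<sigma>))"
    if "\<sigma> \<in> Poly_Mapping.keys c" for \<sigma>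
  proof -
    have "\<sigma> \<subseteq> v ` {1..m}" and "card \<sigma> = Suc \<rho>"
      using that c L by (auto simp: chains_def simplices_def)
    then obtain I where I: "I \<subseteq> {1..m}" "\<sigma> = v ` I"
      using index_set by blast
    then have "card I = Suc \<rho>"
      using \<open>card \<sigma> = Suc \<rho>\<close> inj_v by (metis card_image inj_on_subset)
    then show ?thesis
      using boundary_Omega_single I False by simp
  qed
  then have "linear_extension (\<lambda>\<sigma>. boundary w m \<rho> (Omega v w m \<xi> (?e \<sigma>))) c =
      linear_extension (\<lambda>\<sigma>. Omega v w m \<xi> (boundary v m \<rho> (?e \<sigma>))) c"
    by (rule linear_extension_cong)
  then show ?thesis
    by (subst (1 2) c_basis)
      (simp add: linear_compose_linear_extension linear_Omega linear_boundary)
qed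

text \<open>
  Only vertices among \<open>v 1, \<dots>, v m\<close> occur in \<^const>\<open>vertex_indices\<close>, whatever the chain. The lemma
  puts boundaries into the region where \<open>\<Omega>\<close> is injective.
\<close>

lemma boundary_in_chains_on_vertices: "boundary v m \<rho> c \<in> chains_on_vertices"
proof -
  have facet: "oriented_simplex v (take j (vertex_indices v m \<sigma>) @ drop (Suc j) (vertex_indices v m \<sigma>))
      \<in> chains_on_vertices" for j \<sigma>
  proof -
    have "set (vertex_indices v m \<sigma>) \<subseteq> {1..m}"
      by (auto simp: vertex_indices_def)
    then have "v ` set (take j (vertex_indices v m \<sigma>) @ drop (Suc j) (vertex_indices v m \<sigma>))
        \<subseteq> v ` {1..m}"
      using set_take_subset set_drop_subset by (intro image_mono) fastforce
    then show ?thesis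
      unfolding oriented_simplex_def
      by (intro subspace_scale subspace_chains_on) simp
  qed
  show ?thesis
  proof (cases "\<rho> = 0")
    case False
    show ?thesis
      unfolding boundary_def if_not_P[OF False]
      by (intro subspace_sum subspace_scale subspace_chains_on facet)
  qed (simp add: boundary_def)
qed


section \<open>Relabelling birth-death spaces\<close>

lemma Omega_image_cycles:
  assumes L: "L \<subseteq> Pow (v ` {1..m})"
  shows "Omega v w m \<xi> ` cycles v m \<rho> L = cycles w m \<rho> (relabel v w m \<xi> L)"
proof -
  have "boundary w m \<rho> (Omega v w m \<xi> c) = 0 \<longleftrightarrow> boundary v m \<rho> c = 0" if c: "c \<in> chains L \<rho>" for c
  proof -
    have "boundary v m \<rho> c \<in> chains_on_vertices"
      using c chains_subset_chains_on_vertices[OF L] boundary_in_chains_on_vertices by blast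
    then have "Omega v w m \<xi> (boundary v m \<rho> c) = Omega v w m \<xi> 0 \<longleftrightarrow> boundary v m \<rho> c = 0"
      by (intro inj_on_eq_iff[OF inj_on_Omega]) auto
    then show ?thesis
      by (simp add: boundary_Omega[OF L c] linear_0[OF linear_Omega])
  qed
  then show ?thesis
    unfolding cycles_def Omega_image_chains[OF L, symmetric] by auto
qed

lemma Omega_image_boundaries:
  assumes L: "L \<subseteq> Pow (v ` {1..m})"
  shows "Omega v w m \<xi> ` boundaries v m \<rho> L = boundaries w m \<rho> (relabel v w m \<xi> L)"
  unfolding boundaries_def Omega_image_chains[OF L, symmetric] image_image
  by (intro image_cong refl boundary_Omega[OF L, symmetric])

lemma boundaries_subset_chains_on_vertices:
  assumes L: "L \<subseteq> Pow (v ` {1..m})"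
  shows "boundaries v m \<rho> L \<subseteq> chains_on_vertices"
  using chains_subset_chains_on_vertices[OF L] boundary_in_chains_on_vertices
  unfolding boundaries_def by blast

lemma ZB_subset_chains:
  fixes F :: "'p::order \<Rightarrow> 'v set set"
  assumes "(b, d) \<in> Seg"
  shows "ZB v m \<rho> F (b, d) \<subseteq> chains (F b) \<rho>"
  using assms by (cases d) (auto simp: Seg_def cycles_def)

text \<open>
  The image of the intersection of cycles and boundaries is the intersection of the images because
  \<open>\<Omega>\<close> is injective on a space containing both.
\<close>

lemma Omega_image_ZB:
  fixes F :: "'p::order \<Rightarrow> 'v set set"
  assumes F: "\<And>a. F a \<subseteq> Pow (v ` {1..m})" and s: "s \<in> Seg"
  shows "Omega v w m \<xi> ` ZB v m \<rho> F s = ZB w m \<rho> (relabel_filtration v w m \<xi> F) s"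
proof -
  have cyc: "cycles v m \<rho> (F a) \<subseteq> chains_on_vertices" for a
    using chains_subset_chains_on_vertices[OF F] unfolding cycles_def by blast
  have "Omega v w m \<xi> ` (cycles v m \<rho> (F a) \<inter> boundaries v m \<rho> (F c)) =
      cycles w m \<rho> (relabel v w m \<xi> (F a)) \<inter> boundaries w m \<rho> (relabel v w m \<xi> (F c))" for a c
    using inj_on_image_Int[OF inj_on_Omega cyc boundaries_subset_chains_on_vertices[OF F]]
    by (simp add: Omega_image_cycles[OF F] Omega_image_boundaries[OF F])
  then show ?thesis
    using s unfolding Seg_def
    by (elim UnE CollectE exE conjE) (simp_all add: relabel_filtration_def Omega_image_cycles[OF F])
qed

text \<open>
  An isometry of the chains of \<open>K\<close> onto those of \<open>\<xi>(K)\<close> carries orthogonal complements to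
  orthogonal complements. It is surjectivity that makes this an equality and not just an inclusion.
\<close>

lemma Omega_image_chain_perp:
  assumes K: "K \<subseteq> Pow (v ` {1..m})" and U: "U \<subseteq> chains_on_vertices"
  shows "Omega v w m \<xi> ` chain_perp K \<rho> U =
         chain_perp (relabel v w m \<xi> K) \<rho> (Omega v w m \<xi> ` U)"
proof -
  have "chain_inner (relabel v w m \<xi> K) \<rho> (Omega v w m \<xi> c) (Omega v w m \<xi> u) = chain_inner K \<rho> c u"
    if "c \<in> chains K \<rho>" "u \<in> U" for c u
    using that U chains_subset_chains_on_vertices[OF K] by (intro chain_inner_Omega[OF K]) blast+
  then show ?thesis
    unfolding chain_perp_def Omega_image_chains[OF K, symmetric] by auto
qed

lemma Omega_image_OI:
  fixes F :: "'p::{finite,order} \<Rightarrow> 'v set set"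
  assumes K: "K \<subseteq> Pow (v ` {1..m})" and F: "\<And>a. F a \<subseteq> K" and s: "s \<in> Seg"
  shows "Omega v w m \<xi> ` OI K \<rho> (ZB v m \<rho> F) s =
         OI (relabel v w m \<xi> K) \<rho> (ZB w m \<rho> (relabel_filtration v w m \<xi> F)) s"
proof -
  let ?T = "{t \<in> Seg. t < s}"
  let ?U = "\<Sum>t\<in>?T. ZB v m \<rho> F t"
  have FV: "F a \<subseteq> Pow (v ` {1..m})" for a
    using F K by blast
  have ZB_sub: "ZB v m \<rho> F t \<subseteq> chains_on_vertices" if "t \<in> Seg" for t
    using that ZB_subset_chains[of "fst t" "snd t" \<rho> F] chains_subset_chains_on_vertices[OF FV]
    by (metis prod.collapse subset_trans)
  have U: "?U \<subseteq> chains_on_vertices"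
    using ZB_sub by (intro sum_sets_subset_subspace subspace_chains_on) auto
  have perp: "chain_perp K \<rho> ?U \<subseteq> chains_on_vertices"
    using chains_subset_chains_on_vertices[OF K] unfolding chain_perp_def by blast
  have "Omega v w m \<xi> ` ?U = (\<Sum>t\<in>?T. Omega v w m \<xi> ` ZB v m \<rho> F t)"
    by (rule linear_image_sum_sets[OF linear_Omega])
  also have "\<dots> = (\<Sum>t\<in>?T. ZB w m \<rho> (relabel_filtration v w m \<xi> F) t)"
    by (intro sum.cong) (auto simp: Omega_image_ZB[OF FV])
  finally have "Omega v w m \<xi> ` ?U = (\<Sum>t\<in>?T. ZB w m \<rho> (relabel_filtration v w m \<xi> F) t)" .
  then show ?thesis
    unfolding OI_def
    by (simp add: inj_on_image_Int[OF inj_on_Omega ZB_sub[OF s] perp] Omega_image_ZB[OF FV s]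
        Omega_image_chain_perp[OF K U])
qed

end


theorem proposition4p4:
  fixes v :: "nat \<Rightarrow> 'v" and w :: "nat \<Rightarrow> 'w" and m \<rho> :: nat and \<xi> :: "nat \<Rightarrow> nat"
    and K :: "'v set set" and F :: "'p::{finite,order} \<Rightarrow> 'v set set"
    and b :: 'p and d :: "'p extended"
  assumes "inj_on v {1..m}" and "inj_on w {1..m}"
    and "simplicial_complex (v ` {1..m}) K"
    and "filtration K F"
    and "\<xi> permutes {1..m}"
    and "(b, d) \<in> Seg"
  shows "Omega v w m \<xi> ` OI K \<rho> (ZB v m \<rho> F) (b, d)
       = OI (relabel v w m \<xi> K) \<rho> (ZB w m \<rho> (relabel_filtration v w m \<xi> F)) (b, d)"
proof -
  interpret relabelling v w m \<xi>
    using assms(1,2,5) by unfold_locales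
  have "K \<subseteq> Pow (v ` {1..m})"
    using assms(3) by (auto simp: simplicial_complex_def)
  moreover have "F a \<subseteq> K" for a
    using assms(4) by (auto simp: filtration_def SubCx_def)
  ultimately show ?thesis
    using assms(6) by (rule Omega_image_OI)
qed

end
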